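(* (Progress for the Space-Efficient Parameterized Cast Calculus.) Fix any ComposableCasts structure. For every type $A$ and every closed term $M:\emptyset\vdash A$ of $SC(\Rightarrow)$, one of the following holds: 1. $ctx\vdash M\longrightarrow M'$ for some $M'$ and some $ctx\in\{\mathtt{Any},\mathtt{NonCast}\}$; 2. $M$ is a value; 3. $M=\mathtt{blame}\,\ell$ for some blame label $\ell$.
   Context: **Types.** Base types $b$: $\mathtt{Nat},\mathtt{Bool},\mathtt{Int},\mathtt{Unit},\bot$. Types: $A,B::=b\mid\,?\mid A\to B\mid A\times B\mid A+B$. Contexts $\Gamma$ are finite sequences of types; variables are de Bruijn indices (index $0$ is the last-added type). Primitive types $P::=b\mid b\to P$; each $b$ denotes a set (naturals, Booleans, integers, one-element set, empty set) and $[\![b\to P]\!]$ is the set of functions $[\![b]\!]\to[\![P]\!]$. Blame labels $\ell$ range over a fixed set. **PreCastStruct**: for all types $A,B$ a set $A\Rightarrow B$ of casts; predicates $\mathsf{Inert}$, $\mathsf{Active}$, $\mathsf{Cross}$ on casts; every cast is active or inert; every inert cast $c:A\Rightarrow(B\otimes C)$ with $\otimes\in\{\to,\times,+\}$ is a cross cast and $A=A_1\otimes A_2$ for some $A_1,A_2$; no cast into a base type is inert; and operations taking a cast $c$ and a proof $x$ of $\mathsf{Cross}\,c$: for $c:(A_1\to A_2)\Rightarrow(B_1\to B_2)$, $\mathsf{dom}\,c\,x:B_1\Rightarrow A_1$ and $\mathsf{cod}\,c\,x:A_2\Rightarrow B_2$; for $c:(A_1\times A_2)\Rightarrow(B_1\times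 B_2)$, $\mathsf{fst}\,c\,x:A_1\Rightarrow B_1$ and $\mathsf{snd}\,c\,x:A_2\Rightarrow B_2$; for $c:(A_1+A_2)\Rightarrow(B_1+B_2)$, $\mathsf{inl}\,c\,x:A_1\Rightarrow B_1$ and $\mathsf{inr}\,c\,x:A_2\Rightarrow B_2$. A **ComposableCasts** structure adds: for each simple value $S:\Gamma\vdash A$, $c:A\Rightarrow B$, $a:\mathsf{Active}\,c$, a term $\mathsf{applyCast}\,S\,c\,a:\Gamma\vdash B$; and a composition operation sending $c:A\Rightarrow B$, $d:B\Rightarrow C$ to $c\ast d:A\Rightarrow C$. **Terms** of $SC(\Rightarrow)$ (intrinsically typed; $M:\Gamma\vdash A$): $\$k:P$ for $k\in[\![P]\!]$; $`x:A$ if $x$ has type $A$ in $\Gamma$; $\lambda M:A\to B$ if $M:\Gamma\cdot A\vdash B$; $L\,M:B$ if $L:A\to B$, $M:A$; $\mathtt{if}\,L\,M\,N:B$ if $L:\mathtt{Bool}$, $M,N:B$; $\mathtt{cons}\,M\,N:A\times B$; $\pi_iM:A_i$ if $M:A_1\times A_2$; $\mathtt{inl}[B]M:A+B$ if $M:A$; $\mathtt{inr}[A]M:A+B$ if $M:B$; $\mathtt{case}\,L\,M\,N:B$ if $L:A_1+A_2$, $M:A_1\to B$, $N:A_2\to B$; $M\langle c\rangle:B$ if $M:A$, $c:A\Rightarrow B$; $\mathtt{blame}\,\ell:A$ for every $A$. **Simple values** $S$: $\lambda M$; $\$k$; $\mathtt{cons}\,V\,W$; $\mathtt{inl}[B]V$;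 $\mathtt{inr}[A]V$. **Values** $V,W$: $S$; $S\langle c\rangle$ with $c$ inert. **Frames** $F$ (none for casts): $\Box\,M$; $V\,\Box$; $\mathtt{if}\,\Box\,M\,N$; $\mathtt{cons}\,V\,\Box$; $\mathtt{cons}\,\Box\,N$; $\pi_i\Box$; $\mathtt{inl}[B]\Box$; $\mathtt{inr}[A]\Box$; $\mathtt{case}\,\Box\,M\,N$. **Reduction** $ctx\vdash M\longrightarrow N$, $ctx\in\{\mathtt{Any},\mathtt{NonCast}\}$ ($M[V]$ substitution for variable $0$; $\uparrow$ weakening): - $\mathtt{Any}\vdash F[M]\longrightarrow F[M']$ if $ctx\vdash M\longrightarrow M'$ for some $ctx$; $\mathtt{NonCast}\vdash M\langle c\rangle\longrightarrow M'\langle c\rangle$ if $\mathtt{Any}\vdash M\longrightarrow M'$. - $\mathtt{Any}\vdash F[\mathtt{blame}\,\ell]\longrightarrow\mathtt{blame}\,\ell$; $\mathtt{NonCast}\vdash(\mathtt{blame}\,\ell)\langle c\rangle\longrightarrow\mathtt{blame}\,\ell$. - $\mathtt{NonCast}\vdash S\langle c\rangle\longrightarrow\mathsf{applyCast}\,S\,c\,a$ for $a:\mathsf{Active}\,c$; $\mathtt{NonCast}\vdash M\langle c\rangle\langle d\rangle\longrightarrow M\langle c\ast d\rangle$. - With $ctx=\mathtt{Any}$, for $x:\mathsf{Cross}\,c$: $V\langle c\rangle\,W\longrightarrow(V\,(W\langle\mathsf{dom}\,c\,x\rangle))\langle\mathsf{cod}\,c\,x\rangle$; $\pi_1(V\langle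 c\rangle)\longrightarrow(\pi_1V)\langle\mathsf{fst}\,c\,x\rangle$; $\pi_2(V\langle c\rangle)\longrightarrow(\pi_2V)\langle\mathsf{snd}\,c\,x\rangle$; $\mathtt{case}\,(V\langle c\rangle)\,M\,N\longrightarrow\mathtt{case}\,V\,(\lambda((\uparrow M)\,(`0\langle\mathsf{inl}\,c\,x\rangle)))\,(\lambda((\uparrow N)\,(`0\langle\mathsf{inr}\,c\,x\rangle)))$. - With $ctx=\mathtt{Any}$: $(\lambda M)V\longrightarrow M[V]$; $\mathtt{if}\,\$\mathtt{true}\,M\,N\longrightarrow M$; $\mathtt{if}\,\$\mathtt{false}\,M\,N\longrightarrow N$; $\pi_1(\mathtt{cons}\,V\,W)\longrightarrow V$; $\pi_2(\mathtt{cons}\,V\,W)\longrightarrow W$; $\mathtt{case}(\mathtt{inl}[B]V)\,L\,M\longrightarrow L\,V$; $\mathtt{case}(\mathtt{inr}[A]V)\,L\,M\longrightarrow M\,V$; $\$k\,\$k'\longrightarrow\$(k(k'))$. *)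

theory Defs
  imports Main "HOL-Library.FuncSet"
begin

datatype base = NatB | BoolB | IntB | UnitB | BotB

datatype ty =
    Base base
  | Dyn
  | Fun ty ty   (infixr "\<rightarrow>\<^sub>t" 60)
  | Prod ty ty  (infixr "\<times>\<^sub>t" 62)
  | Sum ty ty   (infixr "+\<^sub>t" 61)

datatype prim = PBase base | PFun base prim

primrec ty_of_prim :: "prim \<Rightarrow> ty" where
  "ty_of_prim (PBase b) = Base b"
| "ty_of_prim (PFun b P) = Base b \<rightarrow>\<^sub>t ty_of_prim P"

datatype bval = VNat nat | VBool bool | VInt int | VUnit

datatype const = CBase bval | CFun "bval \<Rightarrow> const"

primrec base_den :: "base \<Rightarrow> bval set" where
  "base_den NatB = range VNat"
| "base_den BoolB = range VBool"
| "base_den IntB = range VInt"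
| "base_den UnitB = {VUnit}"
| "base_den BotB = {}"

text \<open>
  The extensional function space makes the elements of \<open>prim_den (PFun b P)\<close> correspond
  one-to-one to the set-theoretic functions from \<open>base_den b\<close> to \<open>prim_den P\<close>.
\<close>

primrec prim_den :: "prim \<Rightarrow> const set" where
  "prim_den (PBase b) = CBase ` base_den b"
| "prim_den (PFun b P) = CFun ` (base_den b \<rightarrow>\<^sub>E prim_den P)"

text \<open>
  Terms are intrinsically typed in the calculus, and are rendered here as raw terms together with a
  typing judgment. They carry the type annotations (on literals, abstractions, injections, casts
  and blame) that determine a typing derivation, so that a well-typed raw term in a
  context stands for exactly one intrinsically typed term. Variables are de Bruijn indices.
  \<open>CastTo M A B c\<close> is the application to \<open>M\<close> of the cast \<open>c\<close> taken as an element of the set of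
  casts from \<open>A\<close> to \<open>B\<close>.
\<close>

datatype ('c, 'l) tm =
    Lit prim const
  | Var nat
  | Lam ty "('c, 'l) tm"
  | App "('c, 'l) tm" "('c, 'l) tm"
  | Cond "('c, 'l) tm" "('c, 'l) tm" "('c, 'l) tm"
  | MkPair "('c, 'l) tm" "('c, 'l) tm"
  | Proj1 "('c, 'l) tm"
  | Proj2 "('c, 'l) tm"
  | InL ty "('c, 'l) tm"
  | InR ty "('c, 'l) tm"
  | CaseOf "('c, 'l) tm" "('c, 'l) tm" "('c, 'l) tm"
  | CastTo "('c, 'l) tm" ty ty 'c
  | Blame ty 'l

definition ext :: "(nat \<Rightarrow> nat) \<Rightarrow> nat \<Rightarrow> nat" where
  "ext \<rho> = case_nat 0 (\<lambda>n. Suc (\<rho> n))"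

primrec rename :: "(nat \<Rightarrow> nat) \<Rightarrow> ('c, 'l) tm \<Rightarrow> ('c, 'l) tm" where
  "rename \<rho> (Lit P k) = Lit P k"
| "rename \<rho> (Var x) = Var (\<rho> x)"
| "rename \<rho> (Lam A M) = Lam A (rename (ext \<rho>) M)"
| "rename \<rho> (App L M) = App (rename \<rho> L) (rename \<rho> M)"
| "rename \<rho> (Cond L M N) = Cond (rename \<rho> L) (rename \<rho> M) (rename \<rho> N)"
| "rename \<rho> (MkPair M N) = MkPair (rename \<rho> M) (rename \<rho> N)"
| "rename \<rho> (Proj1 M) = Proj1 (rename \<rho> M)"
| "rename \<rho> (Proj2 M) = Proj2 (rename \<rho> M)"
| "rename \<rho> (InL B M) = InL B (rename \<rho> M)"
| "rename \<rho> (InR A M) = InR A (rename \<rho> M)"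
| "rename \<rho> (CaseOf L M N) = CaseOf (rename \<rho> L) (rename \<rho> M) (rename \<rho> N)"
| "rename \<rho> (CastTo M A B c) = CastTo (rename \<rho> M) A B c"
| "rename \<rho> (Blame A l) = Blame A l"

definition weaken :: "('c, 'l) tm \<Rightarrow> ('c, 'l) tm" where
  "weaken M = rename Suc M"

definition exts :: "(nat \<Rightarrow> ('c, 'l) tm) \<Rightarrow> nat \<Rightarrow> ('c, 'l) tm" where
  "exts \<sigma> = case_nat (Var 0) (\<lambda>n. weaken (\<sigma> n))"

primrec subst :: "(nat \<Rightarrow> ('c, 'l) tm) \<Rightarrow> ('c, 'l) tm \<Rightarrow> ('c, 'l) tm" where
  "subst \<sigma> (Lit P k) = Lit P k"
| "subst \<sigma> (Var x) = \<sigma> x"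
| "subst \<sigma> (Lam A M) = Lam A (subst (exts \<sigma>) M)"
| "subst \<sigma> (App L M) = App (subst \<sigma> L) (subst \<sigma> M)"
| "subst \<sigma> (Cond L M N) = Cond (subst \<sigma> L) (subst \<sigma> M) (subst \<sigma> N)"
| "subst \<sigma> (MkPair M N) = MkPair (subst \<sigma> M) (subst \<sigma> N)"
| "subst \<sigma> (Proj1 M) = Proj1 (subst \<sigma> M)"
| "subst \<sigma> (Proj2 M) = Proj2 (subst \<sigma> M)"
| "subst \<sigma> (InL B M) = InL B (subst \<sigma> M)"
| "subst \<sigma> (InR A M) = InR A (subst \<sigma> M)"
| "subst \<sigma> (CaseOf L M N) = CaseOf (subst \<sigma> L) (subst \<sigma> M) (subst \<sigma> N)"
| "subst \<sigma> (CastTo M A B c) = CastTo (subst \<sigma> M) A B c"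
| "subst \<sigma> (Blame A l) = Blame A l"

definition subst0 :: "('c, 'l) tm \<Rightarrow> ('c, 'l) tm \<Rightarrow> ('c, 'l) tm" where
  "subst0 M V = subst (case_nat V Var) M"

text \<open>
  \<open>casts C A B\<close> is the set of casts from \<open>A\<close> to \<open>B\<close>. The sets for different pairs of types may
  overlap, so every predicate and operation on casts also takes the source and the target type.
\<close>

record 'c pre_cast_struct =
  casts :: "ty \<Rightarrow> ty \<Rightarrow> 'c set"
  Inert :: "ty \<Rightarrow> ty \<Rightarrow> 'c \<Rightarrow> bool"
  Active :: "ty \<Rightarrow> ty \<Rightarrow> 'c \<Rightarrow> bool"
  Cross :: "ty \<Rightarrow> ty \<Rightarrow> 'c \<Rightarrow> bool"
  castDom :: "ty \<Rightarrow> ty \<Rightarrow> 'c \<Rightarrow> 'c"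
  castCod :: "ty \<Rightarrow> ty \<Rightarrow> 'c \<Rightarrow> 'c"
  castFst :: "ty \<Rightarrow> ty \<Rightarrow> 'c \<Rightarrow> 'c"
  castSnd :: "ty \<Rightarrow> ty \<Rightarrow> 'c \<Rightarrow> 'c"
  castInl :: "ty \<Rightarrow> ty \<Rightarrow> 'c \<Rightarrow> 'c"
  castInr :: "ty \<Rightarrow> ty \<Rightarrow> 'c \<Rightarrow> 'c"

locale pre_cast_struct =
  fixes C :: "('c, 'm) pre_cast_struct_scheme"
  assumes active_or_inert:
      "c \<in> casts C A B \<Longrightarrow> Active C A B c \<or> Inert C A B c"
    and inert_fun:
      "c \<in> casts C A (B1 \<rightarrow>\<^sub>t B2) \<Longrightarrow> Inert C A (B1 \<rightarrow>\<^sub>t B2) c \<Longrightarrow>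
        Cross C A (B1 \<rightarrow>\<^sub>t B2) c \<and> (\<exists>A1 A2. A = A1 \<rightarrow>\<^sub>t A2)"
    and inert_prod:
      "c \<in> casts C A (B1 \<times>\<^sub>t B2) \<Longrightarrow> Inert C A (B1 \<times>\<^sub>t B2) c \<Longrightarrow>
        Cross C A (B1 \<times>\<^sub>t B2) c \<and> (\<exists>A1 A2. A = A1 \<times>\<^sub>t A2)"
    and inert_sum:
      "c \<in> casts C A (B1 +\<^sub>t B2) \<Longrightarrow> Inert C A (B1 +\<^sub>t B2) c \<Longrightarrow>
        Cross C A (B1 +\<^sub>t B2) c \<and> (\<exists>A1 A2. A = A1 +\<^sub>t A2)"
    and base_not_inert:
      "c \<in> casts C A (Base b) \<Longrightarrow> \<not> Inert C A (Base b) c"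
    and castDom_casts:
      "c \<in> casts C (A1 \<rightarrow>\<^sub>t A2) (B1 \<rightarrow>\<^sub>t B2) \<Longrightarrow> Cross C (A1 \<rightarrow>\<^sub>t A2) (B1 \<rightarrow>\<^sub>t B2) c \<Longrightarrow>
        castDom C (A1 \<rightarrow>\<^sub>t A2) (B1 \<rightarrow>\<^sub>t B2) c \<in> casts C B1 A1"
    and castCod_casts:
      "c \<in> casts C (A1 \<rightarrow>\<^sub>t A2) (B1 \<rightarrow>\<^sub>t B2) \<Longrightarrow> Cross C (A1 \<rightarrow>\<^sub>t A2) (B1 \<rightarrow>\<^sub>t B2) c \<Longrightarrow>
        castCod C (A1 \<rightarrow>\<^sub>t A2) (B1 \<rightarrow>\<^sub>t B2) c \<in> casts C A2 B2"
    and castFst_casts: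
      "c \<in> casts C (A1 \<times>\<^sub>t A2) (B1 \<times>\<^sub>t B2) \<Longrightarrow> Cross C (A1 \<times>\<^sub>t A2) (B1 \<times>\<^sub>t B2) c \<Longrightarrow>
        castFst C (A1 \<times>\<^sub>t A2) (B1 \<times>\<^sub>t B2) c \<in> casts C A1 B1"
    and castSnd_casts:
      "c \<in> casts C (A1 \<times>\<^sub>t A2) (B1 \<times>\<^sub>t B2) \<Longrightarrow> Cross C (A1 \<times>\<^sub>t A2) (B1 \<times>\<^sub>t B2) c \<Longrightarrow>
        castSnd C (A1 \<times>\<^sub>t A2) (B1 \<times>\<^sub>t B2) c \<in> casts C A2 B2"
    and castInl_casts:
      "c \<in> casts C (A1 +\<^sub>t A2) (B1 +\<^sub>t B2) \<Longrightarrow> Cross C (A1 +\<^sub>t A2) (B1 +\<^sub>t B2) c \<Longrightarrow>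
        castInl C (A1 +\<^sub>t A2) (B1 +\<^sub>t B2) c \<in> casts C A1 B1"
    and castInr_casts:
      "c \<in> casts C (A1 +\<^sub>t A2) (B1 +\<^sub>t B2) \<Longrightarrow> Cross C (A1 +\<^sub>t A2) (B1 +\<^sub>t B2) c \<Longrightarrow>
        castInr C (A1 +\<^sub>t A2) (B1 +\<^sub>t B2) c \<in> casts C A2 B2"

text \<open>A context is a list whose head is the type added last.\<close>

inductive typed :: "('c, 'm) pre_cast_struct_scheme \<Rightarrow> ty list \<Rightarrow> ('c, 'l) tm \<Rightarrow> ty \<Rightarrow> bool"
    ("_; _ \<turnstile> _ \<Colon> _" [51, 51, 51, 51] 50)
  for C :: "('c, 'm) pre_cast_struct_scheme" where
  typed_Lit: "k \<in> prim_den P \<Longrightarrow> C; \<Gamma> \<turnstile> Lit P k \<Colon> ty_of_prim P"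
| typed_Var: "x < length \<Gamma> \<Longrightarrow> C; \<Gamma> \<turnstile> Var x \<Colon> \<Gamma> ! x"
| typed_Lam: "C; A # \<Gamma> \<turnstile> M \<Colon> B \<Longrightarrow> C; \<Gamma> \<turnstile> Lam A M \<Colon> A \<rightarrow>\<^sub>t B"
| typed_App: "C; \<Gamma> \<turnstile> L \<Colon> A \<rightarrow>\<^sub>t B \<Longrightarrow> C; \<Gamma> \<turnstile> M \<Colon> A \<Longrightarrow> C; \<Gamma> \<turnstile> App L M \<Colon> B"
| typed_Cond: "C; \<Gamma> \<turnstile> L \<Colon> Base BoolB \<Longrightarrow> C; \<Gamma> \<turnstile> M \<Colon> B \<Longrightarrow> C; \<Gamma> \<turnstile> N \<Colon> B \<Longrightarrow>
    C; \<Gamma> \<turnstile> Cond L M N \<Colon> B"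
| typed_MkPair: "C; \<Gamma> \<turnstile> M \<Colon> A \<Longrightarrow> C; \<Gamma> \<turnstile> N \<Colon> B \<Longrightarrow> C; \<Gamma> \<turnstile> MkPair M N \<Colon> A \<times>\<^sub>t B"
| typed_Proj1: "C; \<Gamma> \<turnstile> M \<Colon> A1 \<times>\<^sub>t A2 \<Longrightarrow> C; \<Gamma> \<turnstile> Proj1 M \<Colon> A1"
| typed_Proj2: "C; \<Gamma> \<turnstile> M \<Colon> A1 \<times>\<^sub>t A2 \<Longrightarrow> C; \<Gamma> \<turnstile> Proj2 M \<Colon> A2"
| typed_InL: "C; \<Gamma> \<turnstile> M \<Colon> A \<Longrightarrow> C; \<Gamma> \<turnstile> InL B M \<Colon> A +\<^sub>t B"
| typed_InR: "C; \<Gamma> \<turnstile> M \<Colon> B \<Longrightarrow> C; \<Gamma> \<turnstile> InR A M \<Colon> A +\<^sub>t B"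
| typed_CaseOf: "C; \<Gamma> \<turnstile> L \<Colon> A1 +\<^sub>t A2 \<Longrightarrow> C; \<Gamma> \<turnstile> M \<Colon> A1 \<rightarrow>\<^sub>t B \<Longrightarrow> C; \<Gamma> \<turnstile> N \<Colon> A2 \<rightarrow>\<^sub>t B \<Longrightarrow>
    C; \<Gamma> \<turnstile> CaseOf L M N \<Colon> B"
| typed_CastTo: "C; \<Gamma> \<turnstile> M \<Colon> A \<Longrightarrow> c \<in> casts C A B \<Longrightarrow> C; \<Gamma> \<turnstile> CastTo M A B c \<Colon> B"
| typed_Blame: "C; \<Gamma> \<turnstile> Blame A l \<Colon> A"

inductive simple_value :: "('c, 'm) pre_cast_struct_scheme \<Rightarrow> ('c, 'l) tm \<Rightarrow> bool"
  and val :: "('c, 'm) pre_cast_struct_scheme \<Rightarrow> ('c, 'l) tm \<Rightarrow> bool"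
  for C :: "('c, 'm) pre_cast_struct_scheme" where
  simple_Lam: "simple_value C (Lam A M)"
| simple_Lit: "simple_value C (Lit P k)"
| simple_MkPair: "val C V \<Longrightarrow> val C W \<Longrightarrow> simple_value C (MkPair V W)"
| simple_InL: "val C V \<Longrightarrow> simple_value C (InL B V)"
| simple_InR: "val C V \<Longrightarrow> simple_value C (InR A V)"
| val_simple: "simple_value C S \<Longrightarrow> val C S"
| val_CastTo: "simple_value C S \<Longrightarrow> Inert C A B c \<Longrightarrow> val C (CastTo S A B c)"

record ('c, 'l) composable_casts = "'c pre_cast_struct" +
  applyCast :: "ty list \<Rightarrow> ty \<Rightarrow> ty \<Rightarrow> ('c, 'l) tm \<Rightarrow> 'c \<Rightarrow> ('c, 'l) tm"
  compose :: "ty \<Rightarrow> ty \<Rightarrow> ty \<Rightarrow> 'c \<Rightarrow> 'c \<Rightarrow> 'c"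

locale composable_casts = pre_cast_struct C
  for C :: "('c, 'l, 'm) composable_casts_scheme" +
  assumes applyCast_typed:
      "C; \<Gamma> \<turnstile> S \<Colon> A \<Longrightarrow> simple_value C S \<Longrightarrow> c \<in> casts C A B \<Longrightarrow> Active C A B c \<Longrightarrow>
        C; \<Gamma> \<turnstile> applyCast C \<Gamma> A B S c \<Colon> B"
    and compose_casts:
      "c \<in> casts C A B \<Longrightarrow> d \<in> casts C B D \<Longrightarrow> compose C A B D c d \<in> casts C A D"

datatype ('c, 'l) frame =
    FAppL "('c, 'l) tm"
  | FAppR "('c, 'l) tm"
  | FCond "('c, 'l) tm" "('c, 'l) tm"
  | FPairR "('c, 'l) tm"
  | FPairL "('c, 'l) tm"
  | FProj1
  | FProj2
  | FInL ty
  | FInR ty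
  | FCase "('c, 'l) tm" "('c, 'l) tm"

primrec plug :: "('c, 'l) frame \<Rightarrow> ('c, 'l) tm \<Rightarrow> ('c, 'l) tm" where
  "plug (FAppL M) L = App L M"
| "plug (FAppR V) M = App V M"
| "plug (FCond M N) L = Cond L M N"
| "plug (FPairR V) N = MkPair V N"
| "plug (FPairL N) M = MkPair M N"
| "plug FProj1 M = Proj1 M"
| "plug FProj2 M = Proj2 M"
| "plug (FInL B) M = InL B M"
| "plug (FInR A) M = InR A M"
| "plug (FCase M N) L = CaseOf L M N"

text \<open>\<open>frame_typed C \<Gamma> F A B\<close>: \<open>F\<close> is a frame in context \<open>\<Gamma>\<close> with hole of type \<open>A\<close> and result type \<open>B\<close>.\<close>

inductive frame_typed ::
    "('c, 'm) pre_cast_struct_scheme \<Rightarrow> ty list \<Rightarrow> ('c, 'l) frame \<Rightarrow> ty \<Rightarrow> ty \<Rightarrow> bool"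
  for C :: "('c, 'm) pre_cast_struct_scheme" and \<Gamma> :: "ty list" where
  "C; \<Gamma> \<turnstile> M \<Colon> A \<Longrightarrow> frame_typed C \<Gamma> (FAppL M) (A \<rightarrow>\<^sub>t B) B"
| "C; \<Gamma> \<turnstile> V \<Colon> A \<rightarrow>\<^sub>t B \<Longrightarrow> val C V \<Longrightarrow> frame_typed C \<Gamma> (FAppR V) A B"
| "C; \<Gamma> \<turnstile> M \<Colon> B \<Longrightarrow> C; \<Gamma> \<turnstile> N \<Colon> B \<Longrightarrow> frame_typed C \<Gamma> (FCond M N) (Base BoolB) B"
| "C; \<Gamma> \<turnstile> V \<Colon> A \<Longrightarrow> val C V \<Longrightarrow> frame_typed C \<Gamma> (FPairR V) B (A \<times>\<^sub>t B)"
| "C; \<Gamma> \<turnstile> N \<Colon> B \<Longrightarrow> frame_typed C \<Gamma> (FPairL N) A (A \<times>\<^sub>t B)"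
| "frame_typed C \<Gamma> FProj1 (A1 \<times>\<^sub>t A2) A1"
| "frame_typed C \<Gamma> FProj2 (A1 \<times>\<^sub>t A2) A2"
| "frame_typed C \<Gamma> (FInL B) A (A +\<^sub>t B)"
| "frame_typed C \<Gamma> (FInR A) B (A +\<^sub>t B)"
| "C; \<Gamma> \<turnstile> M \<Colon> A1 \<rightarrow>\<^sub>t B \<Longrightarrow> C; \<Gamma> \<turnstile> N \<Colon> A2 \<rightarrow>\<^sub>t B \<Longrightarrow> frame_typed C \<Gamma> (FCase M N) (A1 +\<^sub>t A2) B"

datatype red_ctx = AnyCtx | NonCast

text \<open>
  \<open>red C \<Gamma> A ctx M N\<close> is reduction between terms of type \<open>A\<close> in context \<open>\<Gamma>\<close>. The typing premises
  restrict every rule to well-typed terms, as intrinsic typing does.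
\<close>

inductive red :: "('c, 'l, 'm) composable_casts_scheme \<Rightarrow> ty list \<Rightarrow>
    ty \<Rightarrow> red_ctx \<Rightarrow> ('c, 'l) tm \<Rightarrow> ('c, 'l) tm \<Rightarrow> bool"
  for C :: "('c, 'l, 'm) composable_casts_scheme" and \<Gamma> :: "ty list" where
  red_frame:
    "frame_typed C \<Gamma> F A B \<Longrightarrow> red C \<Gamma> A ctx M M' \<Longrightarrow>
      red C \<Gamma> B AnyCtx (plug F M) (plug F M')"
| red_under_cast:
    "c \<in> casts C A B \<Longrightarrow> red C \<Gamma> A AnyCtx M M' \<Longrightarrow>
      red C \<Gamma> B NonCast (CastTo M A B c) (CastTo M' A B c)"
| red_frame_blame:
    "frame_typed C \<Gamma> F A B \<Longrightarrow> red C \<Gamma> B AnyCtx (plug F (Blame A l)) (Blame B l)"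
| red_cast_blame:
    "c \<in> casts C A B \<Longrightarrow> red C \<Gamma> B NonCast (CastTo (Blame A l) A B c) (Blame B l)"
| red_applyCast:
    "C; \<Gamma> \<turnstile> S \<Colon> A \<Longrightarrow> simple_value C S \<Longrightarrow> c \<in> casts C A B \<Longrightarrow> Active C A B c \<Longrightarrow>
      red C \<Gamma> B NonCast (CastTo S A B c) (applyCast C \<Gamma> A B S c)"
| red_compose:
    "C; \<Gamma> \<turnstile> M \<Colon> A \<Longrightarrow> c \<in> casts C A B \<Longrightarrow> d \<in> casts C B D \<Longrightarrow>
      red C \<Gamma> D NonCast (CastTo (CastTo M A B c) B D d) (CastTo M A D (compose C A B D c d))"
| red_fun_cast:
    "C; \<Gamma> \<turnstile> V \<Colon> A1 \<rightarrow>\<^sub>t A2 \<Longrightarrow> val C V \<Longrightarrow> C; \<Gamma> \<turnstile> W \<Colon> B1 \<Longrightarrow> val C W \<Longrightarrow>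
      c \<in> casts C (A1 \<rightarrow>\<^sub>t A2) (B1 \<rightarrow>\<^sub>t B2) \<Longrightarrow> Cross C (A1 \<rightarrow>\<^sub>t A2) (B1 \<rightarrow>\<^sub>t B2) c \<Longrightarrow>
      red C \<Gamma> B2 AnyCtx (App (CastTo V (A1 \<rightarrow>\<^sub>t A2) (B1 \<rightarrow>\<^sub>t B2) c) W)
        (CastTo (App V (CastTo W B1 A1 (castDom C (A1 \<rightarrow>\<^sub>t A2) (B1 \<rightarrow>\<^sub>t B2) c)))
          A2 B2 (castCod C (A1 \<rightarrow>\<^sub>t A2) (B1 \<rightarrow>\<^sub>t B2) c))"
| red_fst_cast:
    "C; \<Gamma> \<turnstile> V \<Colon> A1 \<times>\<^sub>t A2 \<Longrightarrow> val C V \<Longrightarrow>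
      c \<in> casts C (A1 \<times>\<^sub>t A2) (B1 \<times>\<^sub>t B2) \<Longrightarrow> Cross C (A1 \<times>\<^sub>t A2) (B1 \<times>\<^sub>t B2) c \<Longrightarrow>
      red C \<Gamma> B1 AnyCtx (Proj1 (CastTo V (A1 \<times>\<^sub>t A2) (B1 \<times>\<^sub>t B2) c))
        (CastTo (Proj1 V) A1 B1 (castFst C (A1 \<times>\<^sub>t A2) (B1 \<times>\<^sub>t B2) c))"
| red_snd_cast:
    "C; \<Gamma> \<turnstile> V \<Colon> A1 \<times>\<^sub>t A2 \<Longrightarrow> val C V \<Longrightarrow>
      c \<in> casts C (A1 \<times>\<^sub>t A2) (B1 \<times>\<^sub>t B2) \<Longrightarrow> Cross C (A1 \<times>\<^sub>t A2) (B1 \<times>\<^sub>t B2) c \<Longrightarrow>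
      red C \<Gamma> B2 AnyCtx (Proj2 (CastTo V (A1 \<times>\<^sub>t A2) (B1 \<times>\<^sub>t B2) c))
        (CastTo (Proj2 V) A2 B2 (castSnd C (A1 \<times>\<^sub>t A2) (B1 \<times>\<^sub>t B2) c))"
| red_case_cast:
    "C; \<Gamma> \<turnstile> V \<Colon> A1 +\<^sub>t A2 \<Longrightarrow> val C V \<Longrightarrow> C; \<Gamma> \<turnstile> M \<Colon> B1 \<rightarrow>\<^sub>t D \<Longrightarrow> C; \<Gamma> \<turnstile> N \<Colon> B2 \<rightarrow>\<^sub>t D \<Longrightarrow>
      c \<in> casts C (A1 +\<^sub>t A2) (B1 +\<^sub>t B2) \<Longrightarrow> Cross C (A1 +\<^sub>t A2) (B1 +\<^sub>t B2) c \<Longrightarrow>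
      red C \<Gamma> D AnyCtx (CaseOf (CastTo V (A1 +\<^sub>t A2) (B1 +\<^sub>t B2) c) M N)
        (CaseOf V
          (Lam A1 (App (weaken M) (CastTo (Var 0) A1 B1 (castInl C (A1 +\<^sub>t A2) (B1 +\<^sub>t B2) c))))
          (Lam A2 (App (weaken N) (CastTo (Var 0) A2 B2 (castInr C (A1 +\<^sub>t A2) (B1 +\<^sub>t B2) c)))))"
| red_beta:
    "C; A # \<Gamma> \<turnstile> M \<Colon> B \<Longrightarrow> C; \<Gamma> \<turnstile> V \<Colon> A \<Longrightarrow> val C V \<Longrightarrow>
      red C \<Gamma> B AnyCtx (App (Lam A M) V) (subst0 M V)"
| red_if_true:
    "C; \<Gamma> \<turnstile> M \<Colon> B \<Longrightarrow> C; \<Gamma> \<turnstile> N \<Colon> B \<Longrightarrow>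
      red C \<Gamma> B AnyCtx (Cond (Lit (PBase BoolB) (CBase (VBool True))) M N) M"
| red_if_false:
    "C; \<Gamma> \<turnstile> M \<Colon> B \<Longrightarrow> C; \<Gamma> \<turnstile> N \<Colon> B \<Longrightarrow>
      red C \<Gamma> B AnyCtx (Cond (Lit (PBase BoolB) (CBase (VBool False))) M N) N"
| red_fst:
    "C; \<Gamma> \<turnstile> V \<Colon> A \<Longrightarrow> val C V \<Longrightarrow> C; \<Gamma> \<turnstile> W \<Colon> B \<Longrightarrow> val C W \<Longrightarrow>
      red C \<Gamma> A AnyCtx (Proj1 (MkPair V W)) V"
| red_snd:
    "C; \<Gamma> \<turnstile> V \<Colon> A \<Longrightarrow> val C V \<Longrightarrow> C; \<Gamma> \<turnstile> W \<Colon> B \<Longrightarrow> val C W \<Longrightarrow>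
      red C \<Gamma> B AnyCtx (Proj2 (MkPair V W)) W"
| red_case_inl:
    "C; \<Gamma> \<turnstile> V \<Colon> A \<Longrightarrow> val C V \<Longrightarrow> C; \<Gamma> \<turnstile> L \<Colon> A \<rightarrow>\<^sub>t D \<Longrightarrow> C; \<Gamma> \<turnstile> M \<Colon> B \<rightarrow>\<^sub>t D \<Longrightarrow>
      red C \<Gamma> D AnyCtx (CaseOf (InL B V) L M) (App L V)"
| red_case_inr:
    "C; \<Gamma> \<turnstile> V \<Colon> B \<Longrightarrow> val C V \<Longrightarrow> C; \<Gamma> \<turnstile> L \<Colon> A \<rightarrow>\<^sub>t D \<Longrightarrow> C; \<Gamma> \<turnstile> M \<Colon> B \<rightarrow>\<^sub>t D \<Longrightarrow>
      red C \<Gamma> D AnyCtx (CaseOf (InR A V) L M) (App M V)"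
| red_delta:
    "CFun f \<in> prim_den (PFun b P) \<Longrightarrow> CBase v \<in> prim_den (PBase b) \<Longrightarrow>
      red C \<Gamma> (ty_of_prim P) AnyCtx
        (App (Lit (PFun b P) (CFun f)) (Lit (PBase b) (CBase v))) (Lit P (f v))"

end

theory Submission imports Defs begin

text \<open>
  Progress goes by induction on the typing derivation, using canonical forms for values. The only
  case not settled by plugging a reduction of a subterm into a frame is a cast \<open>M\<langle>c\<rangle>\<close> whose subterm
  \<open>M\<close> steps only in the context \<open>NonCast\<close>. Then \<open>M\<close> is itself a cast, and \<open>M\<langle>c\<rangle>\<close> reduces by composing the two.
  The reduct is well typed by preservation.
\<close>

section \<open>Preservation\<close>

inductive_cases typed_LitE: "C; \<Gamma> \<turnstile> Lit P k \<Colon> A"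
inductive_cases typed_LamE: "C; \<Gamma> \<turnstile> Lam B M \<Colon> A"
inductive_cases typed_MkPairE: "C; \<Gamma> \<turnstile> MkPair M N \<Colon> A"
inductive_cases typed_InLE: "C; \<Gamma> \<turnstile> InL B M \<Colon> A"
inductive_cases typed_InRE: "C; \<Gamma> \<turnstile> InR B M \<Colon> A"
inductive_cases typed_CastToE: "C; \<Gamma> \<turnstile> CastTo M B D c \<Colon> A"

text \<open>In \<open>typed_Var\<close> the type is literally \<open>\<Gamma> ! x\<close>, which
  need not match the type in a goal; here the lookup becomes a separate equation.\<close>

lemma typed_VarI: "x < length \<Gamma> \<Longrightarrow> \<Gamma> ! x = A \<Longrightarrow> C; \<Gamma> \<turnstile> Var x \<Colon> A"
  using typed_Var by blast

text \<open>Renaming precedes substitution because \<open>exts\<close> weakens the substituted terms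
  when it passes a binder. Under \<open>Lam\<close> both the renaming and the target context change,
  hence the generalisation over \<open>\<rho>\<close> and \<open>\<Delta>\<close>.\<close>

lemma typed_rename:
  assumes "C; \<Gamma> \<turnstile> M \<Colon> A"
    and "\<And>x. x < length \<Gamma> \<Longrightarrow> \<rho> x < length \<Delta> \<and> \<Delta> ! \<rho> x = \<Gamma> ! x"
  shows "C; \<Delta> \<turnstile> rename \<rho> M \<Colon> A"
  using assms
proof (induction arbitrary: \<rho> \<Delta> rule: typed.induct)
  case (typed_Lam B \<Gamma> M D)
  have "C; B # \<Delta> \<turnstile> rename (ext \<rho>) M \<Colon> D"
    by (rule typed_Lam.IH) (use typed_Lam.prems in \<open>auto simp: ext_def split: nat.split\<close>)
  then show ?case
    by (simp add: typed.typed_Lam)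
next
  case typed_App
  then show ?case
    by simp (blast intro: typed.typed_App)
next
  case typed_CaseOf
  then show ?case
    by simp (blast intro: typed.typed_CaseOf)
qed (auto intro: typed.intros typed_VarI)

lemma typed_weaken: "C; \<Gamma> \<turnstile> M \<Colon> A \<Longrightarrow> C; B # \<Gamma> \<turnstile> weaken M \<Colon> A"
  unfolding weaken_def by (erule typed_rename) simp

lemma typed_subst:
  assumes "C; \<Gamma> \<turnstile> M \<Colon> A"
    and "\<And>x. x < length \<Gamma> \<Longrightarrow> C; \<Delta> \<turnstile> \<sigma> x \<Colon> \<Gamma> ! x"
  shows "C; \<Delta> \<turnstile> subst \<sigma> M \<Colon> A"
  using assms
proof (induction arbitrary: \<sigma> \<Delta> rule: typed.induct)
  case (typed_Lam B \<Gamma> M D)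
  have "C; B # \<Delta> \<turnstile> subst (exts \<sigma>) M \<Colon> D"
    by (rule typed_Lam.IH)
      (use typed_Lam.prems in \<open>auto simp: exts_def intro: typed_VarI typed_weaken split: nat.split\<close>)
  then show ?case
    by (simp add: typed.typed_Lam)
next
  case typed_App
  then show ?case
    by simp (blast intro: typed.typed_App)
next
  case typed_CaseOf
  then show ?case
    by simp (blast intro: typed.typed_CaseOf)
qed (auto intro: typed.intros)

lemma typed_subst0:
  assumes "C; A # \<Gamma> \<turnstile> M \<Colon> B" and "C; \<Gamma> \<turnstile> V \<Colon> A"
  shows "C; \<Gamma> \<turnstile> subst0 M V \<Colon> B"
  unfolding subst0_def
  by (rule typed_subst[OF assms(1)]) (use assms(2) in \<open>auto intro: typed_VarI split: nat.split\<close>)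

lemma typed_plug: "frame_typed C \<Gamma> F A B \<Longrightarrow> C; \<Gamma> \<turnstile> M \<Colon> A \<Longrightarrow> C; \<Gamma> \<turnstile> plug F M \<Colon> B"
  by (induction rule: frame_typed.induct) (auto intro: typed.intros)

text \<open>The rules of \<open>red\<close> carry typing premises for the pieces of their reducts,
  so induction on the reduction suffices.\<close>

lemma (in composable_casts) preservation: "red C \<Gamma> A ctx M M' \<Longrightarrow> C; \<Gamma> \<turnstile> M' \<Colon> A"
proof (induction rule: red.induct)
  case (red_case_cast V A1 A2 M B1 D N B2 c)
  \<comment> \<open>The cast has moved into the branches, so the scrutinee now has the source type
    of the cast. Its summands do not show in the result type and are given explicitly.\<close>
  then show ?case
    by (intro typed_CaseOf[where ?A1.0 = A1 and ?A2.0 = A2] typed_Lam)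
      (auto intro!: typed_App[OF typed_weaken] typed_CastTo castInl_casts castInr_casts typed_VarI)
next
  case (red_delta f b P v)
  \<comment> \<open>Membership of \<open>CFun f\<close> in \<open>prim_den (PFun b P)\<close> makes
    \<open>f\<close> map \<open>base_den b\<close> into \<open>prim_den P\<close>, so
    \<open>f v\<close> is a legal literal.\<close>
  then show ?case
    by (auto intro!: typed_Lit)
qed (auto intro: typed.intros typed_plug typed_subst0 applyCast_typed compose_casts
    castDom_casts castCod_casts castFst_casts castSnd_casts)

section \<open>Canonical forms\<close>

lemma Base_eq_ty_of_prim: "Base b = ty_of_prim P \<longleftrightarrow> P = PBase b"
  by (cases P) auto

lemma Prod_Sum_neq_ty_of_prim: "A \<times>\<^sub>t B \<noteq> ty_of_prim P" "A +\<^sub>t B \<noteq> ty_of_prim P"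
  by (cases P; simp)+

context pre_cast_struct
begin

text \<open>By \<open>base_not_inert\<close> a value of base type is not a wrapped one, and among
  simple values only literals can have such a type.\<close>

lemma canonical_Base:
  assumes "val C V" and "C; \<Gamma> \<turnstile> V \<Colon> Base b"
  obtains v where "V = Lit (PBase b) (CBase v)" and "v \<in> base_den b"
  using assms(1)
proof (cases rule: val.cases)
  case val_simple
  then show ?thesis
    by (cases rule: simple_value.cases)
      (use assms(2) that in \<open>auto elim!: typed_LamE typed_MkPairE typed_InLE typed_InRE typed_LitE
        simp: Base_eq_ty_of_prim\<close>)
next
  case val_CastTo
  with assms(2) show ?thesis
    by (auto elim!: typed_CastToE simp: base_not_inert)
qed

text \<open>For a wrapped value, \<open>inert_fun\<close> shows that the cast is a cross cast and
  that its source is a function type, which is what \<open>red_fun_cast\<close> demands. Products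
  and sums follow the same pattern, but there literals are excluded.\<close>

lemma canonical_Fun:
  assumes "val C V" and "C; \<Gamma> \<turnstile> V \<Colon> A \<rightarrow>\<^sub>t B"
  obtains (Lam) M where "V = Lam A M" and "C; A # \<Gamma> \<turnstile> M \<Colon> B"
  | (Lit) b P f where "V = Lit (PFun b P) (CFun f)" and "CFun f \<in> prim_den (PFun b P)"
      and "A = Base b" and "B = ty_of_prim P"
  | (CastTo) W A1 A2 c where "V = CastTo W (A1 \<rightarrow>\<^sub>t A2) (A \<rightarrow>\<^sub>t B) c" and "val C W"
      and "C; \<Gamma> \<turnstile> W \<Colon> A1 \<rightarrow>\<^sub>t A2" and "c \<in> casts C (A1 \<rightarrow>\<^sub>t A2) (A \<rightarrow>\<^sub>t B)"
      and "Cross C (A1 \<rightarrow>\<^sub>t A2) (A \<rightarrow>\<^sub>t B) c"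
  using assms(1)
proof (cases rule: val.cases)
  case val_simple
  then show ?thesis
  proof (cases rule: simple_value.cases)
    case (simple_Lit P k)
    with assms(2) have "k \<in> prim_den P" "ty_of_prim P = A \<rightarrow>\<^sub>t B"
      by (auto elim: typed_LitE)
    with simple_Lit Lit show ?thesis
      by (cases P) auto
  qed (use assms(2) Lam in \<open>auto elim: typed_LamE typed_MkPairE typed_InLE typed_InRE\<close>)
next
  case (val_CastTo S A' B' c)
  with assms(2) inert_fun CastTo show ?thesis
    by (metis typed_CastToE val_simple)
qed

lemma canonical_Prod:
  assumes "val C V" and "C; \<Gamma> \<turnstile> V \<Colon> A \<times>\<^sub>t B"
  obtains (MkPair) W1 W2 where "V = MkPair W1 W2" and "val C W1" and "val C W2"
      and "C; \<Gamma> \<turnstile> W1 \<Colon> A" and "C; \<Gamma> \<turnstile> W2 \<Colon> B"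
  | (CastTo) W A1 A2 c where "V = CastTo W (A1 \<times>\<^sub>t A2) (A \<times>\<^sub>t B) c" and "val C W"
      and "C; \<Gamma> \<turnstile> W \<Colon> A1 \<times>\<^sub>t A2" and "c \<in> casts C (A1 \<times>\<^sub>t A2) (A \<times>\<^sub>t B)"
      and "Cross C (A1 \<times>\<^sub>t A2) (A \<times>\<^sub>t B) c"
  using assms(1)
proof (cases rule: val.cases)
  case val_simple
  then show ?thesis
    by (cases rule: simple_value.cases)
      (use assms(2) MkPair in \<open>auto elim!: typed_LamE typed_MkPairE typed_InLE typed_InRE typed_LitE
        simp: Prod_Sum_neq_ty_of_prim\<close>)
next
  case (val_CastTo S A' B' c)
  with assms(2) inert_prod CastTo show ?thesis
    by (metis typed_CastToE val_simple)
qed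

lemma canonical_Sum:
  assumes "val C V" and "C; \<Gamma> \<turnstile> V \<Colon> A +\<^sub>t B"
  obtains (InL) W where "V = InL B W" and "val C W" and "C; \<Gamma> \<turnstile> W \<Colon> A"
  | (InR) W where "V = InR A W" and "val C W" and "C; \<Gamma> \<turnstile> W \<Colon> B"
  | (CastTo) W A1 A2 c where "V = CastTo W (A1 +\<^sub>t A2) (A +\<^sub>t B) c" and "val C W"
      and "C; \<Gamma> \<turnstile> W \<Colon> A1 +\<^sub>t A2" and "c \<in> casts C (A1 +\<^sub>t A2) (A +\<^sub>t B)"
      and "Cross C (A1 +\<^sub>t A2) (A +\<^sub>t B) c"
  using assms(1)
proof (cases rule: val.cases)
  case val_simple
  then show ?thesis
    by (cases rule: simple_value.cases)
      (use assms(2) InL InR in \<open>auto elim!: typed_LamE typed_MkPairE typed_InLE typed_InRE typed_LitE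
        simp: Prod_Sum_neq_ty_of_prim\<close>)
next
  case (val_CastTo S A' B' c)
  with assms(2) inert_sum CastTo show ?thesis
    by (metis typed_CastToE val_simple)
qed

end

section \<open>Progress\<close>

text \<open>The four rules that conclude in \<open>NonCast\<close> all have a cast on their
  left-hand side.\<close>

lemma red_NonCast_is_CastTo:
  assumes "red C \<Gamma> B NonCast M M'"
  obtains N A D c where "M = CastTo N A D c"
  using assms by cases auto

context composable_casts
begin

text \<open>Typing of the reduct is left out, since \<open>preservation\<close> supplies it at the
  end.\<close>

definition progresses :: "ty list \<Rightarrow> ty \<Rightarrow> ('c, 'l) tm \<Rightarrow> bool" where
  "progresses \<Gamma> A M \<longleftrightarrow> (\<exists>ctx M'. red C \<Gamma> A ctx M M') \<or> val C M \<or> (\<exists>l. M = Blame A l)"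

lemma progresses_red: "red C \<Gamma> A ctx M M' \<Longrightarrow> progresses \<Gamma> A M"
  unfolding progresses_def by blast

lemma progresses_val: "val C M \<Longrightarrow> progresses \<Gamma> A M"
  unfolding progresses_def by blast

text \<open>\<open>red_frame\<close> accepts a step of the subterm in either context, and
  \<open>red_frame_blame\<close> propagates blame. Hence only the case of a value in the hole
  remains for each frame.\<close>

lemma progresses_plug:
  assumes "progresses \<Gamma> A M" and "frame_typed C \<Gamma> F A B" and "val C M \<Longrightarrow> progresses \<Gamma> B (plug F M)"
  shows "progresses \<Gamma> B (plug F M)"
  using assms red_frame red_frame_blame unfolding progresses_def by metis

lemma progresses_CastTo:
  assumes "progresses \<Gamma> A M" and M: "C; \<Gamma> \<turnstile> M \<Colon> A" and c: "c \<in> casts C A B"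
  shows "progresses \<Gamma> B (CastTo M A B c)"
proof -
  \<comment> \<open>A cast applied to a cast reduces by \<open>red_compose\<close>, whatever the
    inner term \<open>N\<close> is; typing forces \<open>A' = A\<close>.\<close>
  have composing: ?thesis if "M = CastTo N D A' d" for N D A' d
    using M c that by (auto elim!: typed_CastToE intro: progresses_red red_compose)
  from assms(1) consider ctx M' where "red C \<Gamma> A ctx M M'" | "val C M" | l where "M = Blame A l"
    unfolding progresses_def by blast
  then show ?thesis
  proof cases
    case 1
    then show ?thesis
      using c composing
      by (cases ctx) (auto elim: red_NonCast_is_CastTo intro: progresses_red red_under_cast)
  next
    case 2
    then show ?thesis
    proof (cases rule: val.cases)
      \<comment> \<open>An active cast steps by \<open>red_applyCast\<close>; an inert one forms a
        value.\<close>
      case val_simple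
      with M c active_or_inert[OF c] show ?thesis
        by (blast intro: progresses_red progresses_val red_applyCast val_CastTo)
    qed (use composing in auto)
  next
    case 3
    with c show ?thesis
      by (auto intro: progresses_red red_cast_blame)
  qed
qed

lemma progresses_App_val:
  assumes "val C V" and "C; \<Gamma> \<turnstile> V \<Colon> A \<rightarrow>\<^sub>t B" and W: "val C W" "C; \<Gamma> \<turnstile> W \<Colon> A"
  shows "progresses \<Gamma> B (App V W)"
  using assms(1,2)
proof (cases rule: canonical_Fun)
  case (Lam M)
  with W show ?thesis
    by (auto intro: progresses_red red_beta)
next
  case (Lit b P f)
  \<comment> \<open>The domain of a primitive function is a base type, so the argument is a literal
    and \<open>red_delta\<close> applies.\<close>
  with W obtain v where "W = Lit (PBase b) (CBase v)" "v \<in> base_den b"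
    by (auto elim: canonical_Base)
  with Lit red_delta[of f b P v C \<Gamma>] show ?thesis
    by (auto intro: progresses_red)
next
  case (CastTo U A1 A2 c)
  with W show ?thesis
    by (auto intro: progresses_red red_fun_cast)
qed

lemma progresses_Cond_val:
  assumes "val C V" and "C; \<Gamma> \<turnstile> V \<Colon> Base BoolB" and MN: "C; \<Gamma> \<turnstile> M \<Colon> B" "C; \<Gamma> \<turnstile> N \<Colon> B"
  shows "progresses \<Gamma> B (Cond V M N)"
proof -
  obtain b where "V = Lit (PBase BoolB) (CBase (VBool b))"
    using assms(1,2) by (rule canonical_Base) auto
  with MN show ?thesis
    by (cases b) (auto intro: progresses_red red_if_true red_if_false)
qed

lemma progresses_Proj_val:
  assumes "val C V" and "C; \<Gamma> \<turnstile> V \<Colon> A \<times>\<^sub>t B"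
  shows "progresses \<Gamma> A (Proj1 V)" and "progresses \<Gamma> B (Proj2 V)"
  using assms
  by (cases rule: canonical_Prod;
      auto intro: progresses_red red_fst red_snd red_fst_cast red_snd_cast)+

lemma progresses_CaseOf_val:
  assumes "val C V" and "C; \<Gamma> \<turnstile> V \<Colon> A1 +\<^sub>t A2"
    and "C; \<Gamma> \<turnstile> M \<Colon> A1 \<rightarrow>\<^sub>t B" and "C; \<Gamma> \<turnstile> N \<Colon> A2 \<rightarrow>\<^sub>t B"
  shows "progresses \<Gamma> B (CaseOf V M N)"
  using assms(1,2)
  by (cases rule: canonical_Sum)
    (use assms(3,4) in \<open>auto intro: progresses_red red_case_inl red_case_inr red_case_cast\<close>)

text \<open>Emptiness of the context is a separate equation so that the induction runs over a
  general \<open>\<Gamma>\<close>. It rules out variables; abstractions are values, so their bodies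
  in the extended context are never examined.\<close>

lemma progress:
  assumes "C; \<Gamma> \<turnstile> M \<Colon> A" and "\<Gamma> = []"
  shows "progresses \<Gamma> A M"
  using assms
proof (induction rule: typed.induct)
  case (typed_Lit k P \<Gamma>)
  show ?case
    by (intro progresses_val val_simple simple_Lit)
next
  case (typed_Var x \<Gamma>)
  then show ?case
    by simp
next
  case (typed_Lam A \<Gamma> M B)
  show ?case
    by (intro progresses_val val_simple simple_Lam)
next
  case (typed_App \<Gamma> L A B M)
  \<comment> \<open>The frame \<open>FAppR L\<close> requires a value \<open>L\<close>, so the
    argument is considered only after the function position is settled.\<close>
  have "progresses \<Gamma> B (App L M)" if "val C L"
    using progresses_plug[of \<Gamma> A M "FAppR L" B] progresses_App_val[of L \<Gamma> A B M] that typed_App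
    by (simp add: frame_typed.intros)
  then show ?case
    using progresses_plug[of \<Gamma> "A \<rightarrow>\<^sub>t B" L "FAppL M" B] typed_App
    by (simp add: frame_typed.intros)
next
  case (typed_Cond \<Gamma> L M B N)
  then show ?case
    using progresses_plug[of \<Gamma> _ L "FCond M N" B] progresses_Cond_val
    by (simp add: frame_typed.intros)
next
  case (typed_MkPair \<Gamma> M A N B)
  have "progresses \<Gamma> (A \<times>\<^sub>t B) (MkPair M N)" if "val C M"
    using progresses_plug[of \<Gamma> B N "FPairR M" "A \<times>\<^sub>t B"] that typed_MkPair
    by (simp add: frame_typed.intros progresses_val val_simple simple_MkPair)
  then show ?case
    using progresses_plug[of \<Gamma> A M "FPairL N" "A \<times>\<^sub>t B"] typed_MkPair
    by (simp add: frame_typed.intros)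
next
  case (typed_Proj1 \<Gamma> M A1 A2)
  then show ?case
    using progresses_plug[of \<Gamma> "A1 \<times>\<^sub>t A2" M FProj1 A1] progresses_Proj_val(1)
    by (simp add: frame_typed.intros)
next
  case (typed_Proj2 \<Gamma> M A1 A2)
  then show ?case
    using progresses_plug[of \<Gamma> "A1 \<times>\<^sub>t A2" M FProj2 A2] progresses_Proj_val(2)
    by (simp add: frame_typed.intros)
next
  case (typed_InL \<Gamma> M A B)
  then show ?case
    using progresses_plug[of \<Gamma> A M "FInL B" "A +\<^sub>t B"]
    by (simp add: frame_typed.intros progresses_val val_simple simple_InL)
next
  case (typed_InR \<Gamma> M B A)
  then show ?case
    using progresses_plug[of \<Gamma> B M "FInR A" "A +\<^sub>t B"]
    by (simp add: frame_typed.intros progresses_val val_simple simple_InR)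
next
  case (typed_CaseOf \<Gamma> L A1 A2 M B N)
  then show ?case
    using progresses_plug[of \<Gamma> "A1 +\<^sub>t A2" L "FCase M N" B] progresses_CaseOf_val
    by (simp add: frame_typed.intros)
next
  case (typed_CastTo \<Gamma> M A c B)
  then show ?case
    by (simp add: progresses_CastTo)
next
  case (typed_Blame \<Gamma> A l)
  show ?case
    by (simp add: progresses_def)
qed

end

theorem theorem116:
  fixes C :: "('c, 'l) composable_casts"
    and A :: ty
    and M :: "('c, 'l) tm"
  assumes "composable_casts C"
    and "C; [] \<turnstile> M \<Colon> A"
  shows "(\<exists>ctx M'. (C; [] \<turnstile> M' \<Colon> A) \<and> red C [] A ctx M M')
    \<or> val C M
    \<or> (\<exists>l. M = Blame A l)"
proof -
  interpret composable_casts C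
    by (fact assms(1))
  show ?thesis
    using progress[OF assms(2) refl] preservation unfolding progresses_def by blast
qed

end
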